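(* Let $n\ge 2$, let $k\in\{1,\dots,n-1\}$, let $r:=\binom{n}{k}$, and let $A\in\mathbb{R}^{n\times n}$ be sign-regular of order $k$ with signature $\epsilon_k=1$, i.e. all the entries of the $k$th multiplicative compound $A^{(k)}\in\mathbb{R}^{r\times r}$ are non-negative. Then the following statements are equivalent: (a) the matrix $A^{(k)}$ is Schur, i.e. $\rho(A^{(k)})<1$; (b) there exists $\xi\in\mathbb{R}^r$ with $\xi\gg 0$ such that $A^{(k)}\xi\ll\xi$; (c) there exists $z\in\mathbb{R}^r$ with $z\gg 0$ such that $(A^{(k)})^Tz\ll z$; (d) there exists a diagonal matrix $D\in\mathbb{R}^{r\times r}$ with positive diagonal entries such that $(A^{(k)})^TDA^{(k)}\prec D$; (e) the matrix $I-A^{(k)}$ is nonsingular and $(I-A^{(k)})^{-1}\ge 0$.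
   Context: For $A\in\mathbb{R}^{n\times n}$ and $k\in\{1,\dots,n\}$, the $k$th multiplicative compound $A^{(k)}$ is the $\binom{n}{k}\times\binom{n}{k}$ matrix whose entries are all the $k\times k$ minors of $A$, with rows and columns indexed by the $k$-element subsets (increasing sequences) of $\{1,\dots,n\}$ in lexicographic order. $\rho(\cdot)$ denotes the spectral radius. For vectors and matrices, $X\ge 0$ [$X\gg 0$] means that all entries of $X$ are non-negative [positive], and $u\ll v$ means $v-u\gg 0$. For symmetric matrices, $P\prec Q$ means that $Q-P$ is positive-definite. *)

theory Defs
  imports
    "HOL-Library.List_Lexorder"
    "Jordan_Normal_Form.DL_Submatrix"
    "Jordan_Normal_Form.Spectral_Radius"
begin

text \<open>Indices are 0-based, as in the matrix library: a \<open>k\<close>-element subset of \<open>{1,\<dots>,n}\<close> becomes a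
  strictly increasing list of length \<open>k\<close> over \<open>{0..<n}\<close>. The order used by
  \<^const>\<open>sorted_list_of_set\<close> below is the lexicographic order on lists of
  \<^theory>\<open>HOL-Library.List_Lexorder\<close>.\<close>

definition inc_seqs :: "nat \<Rightarrow> nat \<Rightarrow> nat list set" where
  "inc_seqs n k = {xs. length xs = k \<and> sorted_wrt (<) xs \<and> set xs \<subseteq> {0..<n}}"

definition lex_seqs :: "nat \<Rightarrow> nat \<Rightarrow> nat list list" where
  "lex_seqs n k = sorted_list_of_set (inc_seqs n k)"

definition mult_compound :: "nat \<Rightarrow> 'a :: comm_ring_1 mat \<Rightarrow> 'a mat" where
  "mult_compound k A =
     mat (dim_row A choose k) (dim_col A choose k)
       (\<lambda>(i, j). det (submatrix A (set (lex_seqs (dim_row A) k ! i)) (set (lex_seqs (dim_col A) k ! j))))"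

definition sign_regular :: "nat \<Rightarrow> real \<Rightarrow> real mat \<Rightarrow> bool" where
  "sign_regular k eps A \<longleftrightarrow>
     eps \<in> {-1, 1} \<and>
     (\<forall>i < dim_row (mult_compound k A). \<forall>j < dim_col (mult_compound k A).
        0 \<le> eps * mult_compound k A $$ (i, j))"

definition schur_matrix :: "real mat \<Rightarrow> bool" where
  "schur_matrix M \<longleftrightarrow> spectral_radius (map_mat complex_of_real M) < 1"

text \<open>The library's \<open><\<close> on vectors is not the entrywise strict order (it is \<open>v \<le> w \<and> \<not> w \<le> v\<close>),
  hence a separate relation.\<close>

definition vec_lless :: "real vec \<Rightarrow> real vec \<Rightarrow> bool" (infix "\<lless>\<^sub>v" 50) where
  "v \<lless>\<^sub>v w \<longleftrightarrow> dim_vec v = dim_vec w \<and> (\<forall>i < dim_vec w. v $ i < w $ i)"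

definition pos_def_mat :: "real mat \<Rightarrow> bool" where
  "pos_def_mat M \<longleftrightarrow>
     M\<^sup>T = M \<and>
     (\<forall>x \<in> carrier_vec (dim_row M). x \<noteq> 0\<^sub>v (dim_row M) \<longrightarrow> 0 < x \<bullet> (M *\<^sub>v x))"

definition loewner_less :: "real mat \<Rightarrow> real mat \<Rightarrow> bool" (infix "\<prec>\<^sub>m" 50) where
  "P \<prec>\<^sub>m Q \<longleftrightarrow>
     dim_row P = dim_row Q \<and> P\<^sup>T = P \<and> Q\<^sup>T = Q \<and> pos_def_mat (Q - P)"

lemma finite_inc_seqs: "finite (inc_seqs n k)"
  by (rule finite_subset[OF _ finite_lists_length_eq[of "{0..<n}" k]]) (auto simp: inc_seqs_def)

lemma bij_betw_set_inc_seqs: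
  "bij_betw set (inc_seqs n k) {S. S \<subseteq> {0..<n} \<and> card S = k}"
proof (rule bij_betw_byWitness[where f' = sorted_list_of_set])
  show "\<forall>xs\<in>inc_seqs n k. sorted_list_of_set (set xs) = xs"
    by (auto simp: inc_seqs_def strict_sorted_iff sorted_list_of_set.idem_if_sorted_distinct)
  show "\<forall>S\<in>{S. S \<subseteq> {0..<n} \<and> card S = k}. set (sorted_list_of_set S) = S"
    using finite_subset by fastforce
  show "set ` inc_seqs n k \<subseteq> {S. S \<subseteq> {0..<n} \<and> card S = k}"
    by (auto simp: inc_seqs_def strict_sorted_iff distinct_card)
  show "sorted_list_of_set ` {S. S \<subseteq> {0..<n} \<and> card S = k} \<subseteq> inc_seqs n k"
  proof
    fix xs assume "xs \<in> sorted_list_of_set ` {S. S \<subseteq> {0..<n} \<and> card S = k}"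
    then obtain S where S: "S \<subseteq> {0..<n}" "card S = k" "xs = sorted_list_of_set S" by auto
    moreover have "finite S" using S(1) finite_subset by blast
    ultimately show "xs \<in> inc_seqs n k" by (simp add: inc_seqs_def)
  qed
qed

lemma length_lex_seqs: "length (lex_seqs n k) = n choose k"
  using bij_betw_same_card[OF bij_betw_set_inc_seqs[of n k]] n_subsets[of "{0..<n}" k]
  by (simp add: lex_seqs_def)

lemma set_lex_seqs: "set (lex_seqs n k) = inc_seqs n k"
  by (simp add: lex_seqs_def finite_inc_seqs)

lemma mult_compound_carrier:
  assumes "A \<in> carrier_mat n m"
  shows "mult_compound k A \<in> carrier_mat (n choose k) (m choose k)"
  using assms by (auto simp: mult_compound_def)

end

theory Submission
  imports Defs "HOL-Analysis.L2_Norm"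
begin

text \<open>Only non-negativity of \<open>M = A\<^sup>(\<^sup>k\<^sup>)\<close> matters. If \<open>\<rho>(M) < 1\<close>, the Neumann series
  \<open>B = \<Sum>\<^sub>m M\<^sup>m\<close> converges and is a non-negative inverse of \<open>I - M\<close>. Conversely, for a non-negative
  inverse \<open>B\<close> the row sums \<open>\<xi>\<close> and the column sums \<open>z\<close> of \<open>B\<close> are positive with
  \<open>M \<xi> \<lless> \<xi>\<close> and \<open>M\<^sup>T z \<lless> z\<close>. Given both vectors, \<open>D = diag (z\<^sub>i / \<xi>\<^sub>i)\<close> satisfies the Stein
  inequality, by Cauchy--Schwarz with weights \<open>M\<^sub>i\<^sub>j \<xi>\<^sub>j\<close>. Finally each of \<open>\<xi>\<close>, \<open>z\<close>, \<open>D\<close> gives a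
  norm on complex vectors (weighted sup, weighted \<open>\<ell>\<^sup>1\<close>, weighted \<open>\<ell>\<^sup>2\<close>) in which \<open>M\<close> strictly
  shrinks eigenvectors, so \<open>\<rho>(M) < 1\<close>.\<close>

section \<open>Entries of matrix products as finite sums\<close>

lemma index_mult_mat_vec_sum:
  assumes "M \<in> carrier_mat m n" "v \<in> carrier_vec n" "i < m"
  shows "(M *\<^sub>v v) $ i = (\<Sum>j<n. M $$ (i, j) * v $ j)"
  using assms by (auto simp: scalar_prod_def lessThan_atLeast0 intro!: sum.cong)

lemma index_mult_mat_sum:
  assumes "M \<in> carrier_mat m n" "N \<in> carrier_mat n p" "i < m" "j < p"
  shows "(M * N) $$ (i, j) = (\<Sum>l<n. M $$ (i, l) * N $$ (l, j))"
  using assms by (auto simp: scalar_prod_def lessThan_atLeast0 intro!: sum.cong)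

section \<open>Sufficient criteria for the Schur property via weighted norms\<close>

text \<open>Positivity of \<open>r\<close> makes the spectrum non-empty, so the spectral radius is
  attained by an eigenvalue and bounds all others.\<close>

lemma schur_matrix_iff_eigenvalues:
  assumes M: "M \<in> carrier_mat r r" and r: "r > 0"
  shows "schur_matrix M \<longleftrightarrow> (\<forall>a. eigenvalue (map_mat complex_of_real M) a \<longrightarrow> cmod a < 1)"
proof -
  have C: "map_mat complex_of_real M \<in> carrier_mat r r" using M by simp
  show ?thesis
    using spectral_radius_mem_max[OF C r]
    unfolding schur_matrix_def spectrum_def by fastforce
qed

text \<open>Common interface for the three norm arguments below. An eigenvector enters as a function
  with one non-zero coordinate below \<open>r\<close>, so that they deal with plain finite
  sums.\<close>

lemma schur_matrixI:
  assumes M: "M \<in> carrier_mat r r" and r: "r > 0"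
    and contr: "\<And>a v i. \<lbrakk>i < r; v i \<noteq> 0;
      \<And>i. i < r \<Longrightarrow> (\<Sum>j<r. complex_of_real (M $$ (i, j)) * v j) = a * v i\<rbrakk> \<Longrightarrow> cmod a < 1"
  shows "schur_matrix M"
  unfolding schur_matrix_iff_eigenvalues[OF M r]
proof (intro allI impI)
  fix a assume "eigenvalue (map_mat complex_of_real M) a"
  then obtain v where v: "v \<in> carrier_vec r" "v \<noteq> 0\<^sub>v r"
    and eq: "map_mat complex_of_real M *\<^sub>v v = a \<cdot>\<^sub>v v"
    using M unfolding eigenvalue_def eigenvector_def by auto
  obtain i where i: "i < r" "v $ i \<noteq> 0" using v by (auto simp: vec_eq_iff)
  have "(\<Sum>j<r. complex_of_real (M $$ (i, j)) * v $ j) = a * v $ i" if "i < r" for i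
  proof -
    have "(\<Sum>j<r. complex_of_real (M $$ (i, j)) * v $ j) = (map_mat complex_of_real M *\<^sub>v v) $ i"
      using M v that by (subst index_mult_mat_vec_sum[of _ r r]) auto
    then show ?thesis using eq v that by simp
  qed
  then show "cmod a < 1" using contr[of i "\<lambda>i. v $ i" a] i by blast
qed

text \<open>Triangle inequality: since \<open>M\<close> is non-negative, the moduli of an
  eigenvector form a real vector \<open>w\<close> with \<open>|a| w \<le> M w\<close>
  entrywise.\<close>

lemma cmod_eigen_le:
  assumes nonneg: "\<And>i j. i < r \<Longrightarrow> j < r \<Longrightarrow> 0 \<le> M $$ (i, j)"
    and eq: "(\<Sum>j<r. complex_of_real (M $$ (i, j)) * v j) = a * v i" and i: "i < r"
  shows "cmod a * cmod (v i) \<le> (\<Sum>j<r. M $$ (i, j) * cmod (v j))"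
proof -
  have "cmod a * cmod (v i) = cmod (\<Sum>j<r. complex_of_real (M $$ (i, j)) * v j)"
    by (simp add: eq norm_mult)
  also have "\<dots> \<le> (\<Sum>j<r. cmod (complex_of_real (M $$ (i, j)) * v j))" by (rule norm_sum)
  also have "\<dots> = (\<Sum>j<r. M $$ (i, j) * cmod (v j))"
    using nonneg i by (intro sum.cong) (auto simp: norm_mult)
  finally show ?thesis .
qed

text \<open>Weighted sup norm, the maximum of \<open>cmod (v i) / x i\<close>: the eigenvalue
  equation is read off in a row where the maximum is attained, and there \<open>M x < x\<close>
  gives the strict contraction.\<close>

lemma schur_matrix_if_subinvariant:
  fixes x :: "nat \<Rightarrow> real"
  assumes M: "M \<in> carrier_mat r r" and r: "r > 0"
    and nonneg: "\<And>i j. i < r \<Longrightarrow> j < r \<Longrightarrow> 0 \<le> M $$ (i, j)"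
    and pos: "\<And>i. i < r \<Longrightarrow> 0 < x i"
    and sub: "\<And>i. i < r \<Longrightarrow> (\<Sum>j<r. M $$ (i, j) * x j) < x i"
  shows "schur_matrix M"
proof (rule schur_matrixI[OF M r])
  fix a v i0
  assume i0: "i0 < r" "v i0 \<noteq> 0"
    and eq: "\<And>i. i < r \<Longrightarrow> (\<Sum>j<r. complex_of_real (M $$ (i, j)) * v j) = a * v i"
  define m where "m = Max ((\<lambda>i. cmod (v i) / x i) ` {..<r})"
  have "m \<in> (\<lambda>i. cmod (v i) / x i) ` {..<r}" unfolding m_def using r by (intro Max_in) auto
  then obtain i where i: "i < r" "m = cmod (v i) / x i" by auto
  have le_m: "cmod (v j) / x j \<le> m" if "j < r" for j
    unfolding m_def using that by (intro Max_ge) auto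
  \<comment> \<open>The non-zero coordinate keeps the maximum away from 0, so that it can be
    cancelled at the end.\<close>
  have "0 < cmod (v i0) / x i0" using i0 pos by simp
  then have m: "m > 0" using le_m[OF i0(1)] by linarith
  have le: "cmod (v j) \<le> m * x j" if "j < r" for j
    using le_m[OF that] pos[OF that] by (simp add: field_simps)
  have vi: "cmod (v i) = m * x i" using i pos[OF i(1)] by simp
  have "cmod a * cmod (v i) \<le> (\<Sum>j<r. M $$ (i, j) * cmod (v j))"
    by (rule cmod_eigen_le[OF nonneg eq[OF i(1)] i(1)])
  also have "\<dots> \<le> (\<Sum>j<r. M $$ (i, j) * (m * x j))"
    using le nonneg i by (intro sum_mono mult_left_mono) auto
  also have "\<dots> = m * (\<Sum>j<r. M $$ (i, j) * x j)"
    by (simp add: sum_distrib_left algebra_simps)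
  also have "\<dots> < m * x i" using sub[OF i(1)] m by simp
  finally have "cmod a * (m * x i) < 1 * (m * x i)" using vi by simp
  then show "cmod a < 1" using m pos[OF i(1)] by (simp add: mult_less_cancel_right)
qed

text \<open>Weighted l1 norm with weights \<open>z\<close>: exchanging the two sums moves
  \<open>M\<close> from the eigenvector to the weights, where the column inequality applies.\<close>

lemma schur_matrix_if_transpose_subinvariant:
  fixes z :: "nat \<Rightarrow> real"
  assumes M: "M \<in> carrier_mat r r" and r: "r > 0"
    and nonneg: "\<And>i j. i < r \<Longrightarrow> j < r \<Longrightarrow> 0 \<le> M $$ (i, j)"
    and pos: "\<And>i. i < r \<Longrightarrow> 0 < z i"
    and sub: "\<And>j. j < r \<Longrightarrow> (\<Sum>i<r. M $$ (i, j) * z i) < z j"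
  shows "schur_matrix M"
proof (rule schur_matrixI[OF M r])
  fix a v i0
  assume i0: "i0 < r" "v i0 \<noteq> 0"
    and eq: "\<And>i. i < r \<Longrightarrow> (\<Sum>j<r. complex_of_real (M $$ (i, j)) * v j) = a * v i"
  let ?n = "\<Sum>i<r. z i * cmod (v i)"
  have "z i0 * cmod (v i0) \<le> ?n"
    using pos i0 by (intro member_le_sum) (auto simp: less_imp_le)
  moreover have "0 < z i0 * cmod (v i0)" using pos i0 by simp
  ultimately have n: "?n > 0" by linarith
  have "cmod a * ?n = (\<Sum>i<r. z i * (cmod a * cmod (v i)))"
    by (simp add: sum_distrib_left algebra_simps)
  also have "\<dots> \<le> (\<Sum>i<r. z i * (\<Sum>j<r. M $$ (i, j) * cmod (v j)))"
    using cmod_eigen_le[OF nonneg eq] pos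
    by (intro sum_mono mult_left_mono) (auto simp: less_imp_le)
  also have "\<dots> = (\<Sum>j<r. (\<Sum>i<r. M $$ (i, j) * z i) * cmod (v j))"
    unfolding sum_distrib_left sum_distrib_right
    by (subst sum.swap) (simp add: algebra_simps)
  also have "\<dots> < ?n"
  proof (rule sum_strict_mono_ex1)
    \<comment> \<open>Columns with \<open>v j = 0\<close> give only equality; strictness comes from
      \<open>i0\<close>.\<close>
    show "\<exists>j\<in>{..<r}. (\<Sum>i<r. M $$ (i, j) * z i) * cmod (v j) < z j * cmod (v j)"
      using sub i0 by (intro bexI[of _ i0]) auto
  qed (use sub in \<open>auto simp: less_imp_le intro!: mult_right_mono\<close>)
  finally show "cmod a < 1" using n by simp
qed

text \<open>Weighted l2 norm with weights \<open>d\<close>. The hypothesis concerns real vectors;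
  since \<open>M\<close> is real, it applies separately to the real and imaginary parts of an
  eigenvector, whose squared norms add up.\<close>

lemma schur_matrix_if_stein:
  fixes d :: "nat \<Rightarrow> real"
  assumes M: "M \<in> carrier_mat r r" and r: "r > 0"
    and pos: "\<And>i. i < r \<Longrightarrow> 0 < d i"
    and stein: "\<And>x. \<exists>i<r. x i \<noteq> 0 \<Longrightarrow>
      (\<Sum>i<r. d i * (\<Sum>j<r. M $$ (i, j) * x j)\<^sup>2) < (\<Sum>i<r. d i * (x i)\<^sup>2)"
  shows "schur_matrix M"
proof (rule schur_matrixI[OF M r])
  fix a v i0
  assume i0: "i0 < r" "v i0 \<noteq> 0"
    and eq: "\<And>i. i < r \<Longrightarrow> (\<Sum>j<r. complex_of_real (M $$ (i, j)) * v j) = a * v i"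
  let ?n = "\<Sum>i<r. d i * (cmod (v i))\<^sup>2"
  let ?Q = "\<lambda>x. \<Sum>i<r. d i * (\<Sum>j<r. M $$ (i, j) * x j)\<^sup>2"
  \<comment> \<open>The weak form also covers zero vectors: one of the real and imaginary parts may
    vanish, but not both.\<close>
  have le: "?Q x \<le> (\<Sum>i<r. d i * (x i)\<^sup>2)" for x
  proof (cases "\<exists>i<r. x i \<noteq> 0")
    case True then show ?thesis using stein[of x] by simp
  qed simp
  have "(cmod a)\<^sup>2 * ?n = (\<Sum>i<r. d i * (cmod (a * v i))\<^sup>2)"
    by (simp add: sum_distrib_left norm_mult power_mult_distrib algebra_simps)
  also have "\<dots> = (\<Sum>i<r. d i * (cmod (\<Sum>j<r. complex_of_real (M $$ (i, j)) * v j))\<^sup>2)"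
    using eq by simp
  also have "\<dots> = ?Q (\<lambda>j. Re (v j)) + ?Q (\<lambda>j. Im (v j))"
    by (simp add: cmod_power2 distrib_left sum.distrib)
  also have "\<dots> < (\<Sum>i<r. d i * (Re (v i))\<^sup>2) + (\<Sum>i<r. d i * (Im (v i))\<^sup>2)"
  proof (cases "Re (v i0) = 0")
    case True
    then have "Im (v i0) \<noteq> 0" using i0 by (simp add: complex_eq_iff)
    then show ?thesis using le[of "\<lambda>j. Re (v j)"] stein[of "\<lambda>j. Im (v j)"] i0
      by (intro add_le_less_mono) auto
  next
    case False
    then show ?thesis using le[of "\<lambda>j. Im (v j)"] stein[of "\<lambda>j. Re (v j)"] i0
      by (intro add_less_le_mono) auto
  qed
  also have "\<dots> = ?n" by (simp add: cmod_power2 distrib_left sum.distrib)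
  finally have "(cmod a)\<^sup>2 * ?n < 1 * ?n" by simp
  moreover have "?n \<ge> 0" using pos by (intro sum_nonneg) (auto simp: less_imp_le)
  ultimately have "(cmod a)\<^sup>2 < 1" by (rule mult_right_less_imp_less)
  then show "cmod a < 1" by (simp add: abs_square_less_1)
qed

section \<open>Cauchy-Schwarz and the diagonal Stein inequality\<close>

lemma sum_mult_squared_le:
  fixes f g :: "'a \<Rightarrow> real"
  shows "(\<Sum>i\<in>I. f i * g i)\<^sup>2 \<le> (\<Sum>i\<in>I. (f i)\<^sup>2) * (\<Sum>i\<in>I. (g i)\<^sup>2)"
proof -
  have "\<bar>\<Sum>i\<in>I. f i * g i\<bar> \<le> (\<Sum>i\<in>I. \<bar>f i\<bar> * \<bar>g i\<bar>)"
    using sum_abs[of "\<lambda>i. f i * g i" I] by (simp add: abs_mult)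
  also have "\<dots> \<le> L2_set f I * L2_set g I" by (rule L2_set_mult_ineq)
  finally have "(\<Sum>i\<in>I. f i * g i)\<^sup>2 \<le> (L2_set f I * L2_set g I)\<^sup>2"
    by (metis abs_ge_zero power2_abs power_mono)
  then show ?thesis by (simp add: L2_set_def power_mult_distrib sum_nonneg)
qed

text \<open>Cauchy-Schwarz in row \<open>i\<close> bounds \<open>(M u)_i\<close> squared by
  \<open>(M x)_i\<close> times the sum of \<open>M_ij u_j^2 / x_j\<close>. The bound
  \<open>(M x)_i \<le> x_i\<close> cancels the denominator of the weight \<open>z i / x i\<close>,
  and summing over \<open>i\<close> leaves the column sums weighted by \<open>z\<close>, which are
  below \<open>z j\<close>.\<close>

lemma stein_if_subinvariant:
  fixes x z u :: "nat \<Rightarrow> real"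
  assumes nonneg: "\<And>i j. i < r \<Longrightarrow> j < r \<Longrightarrow> 0 \<le> M $$ (i, j)"
    and x: "\<And>i. i < r \<Longrightarrow> 0 < x i" "\<And>i. i < r \<Longrightarrow> (\<Sum>j<r. M $$ (i, j) * x j) < x i"
    and z: "\<And>i. i < r \<Longrightarrow> 0 < z i" "\<And>j. j < r \<Longrightarrow> (\<Sum>i<r. M $$ (i, j) * z i) < z j"
    and u: "\<exists>i<r. u i \<noteq> 0"
  shows "(\<Sum>i<r. z i / x i * (\<Sum>j<r. M $$ (i, j) * u j)\<^sup>2) < (\<Sum>i<r. z i / x i * (u i)\<^sup>2)"
proof -
  have row: "z i / x i * (\<Sum>j<r. M $$ (i, j) * u j)\<^sup>2 \<le> z i * (\<Sum>j<r. M $$ (i, j) * ((u j)\<^sup>2 / x j))"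
    if i: "i < r" for i
  proof -
    let ?S = "\<Sum>j<r. M $$ (i, j) * ((u j)\<^sup>2 / x j)"
    have S: "?S \<ge> 0" using nonneg x i by (intro sum_nonneg mult_nonneg_nonneg) (auto simp: less_imp_le)
    \<comment> \<open>Each term is split so that the squares of the two factors are
      \<open>M_ij x_j\<close> and \<open>M_ij u_j^2 / x_j\<close>.\<close>
    have "(\<Sum>j<r. M $$ (i, j) * u j)\<^sup>2
        = (\<Sum>j<r. sqrt (M $$ (i, j) * x j) * (sqrt (M $$ (i, j) / x j) * u j))\<^sup>2"
    proof (rule arg_cong[where f = "\<lambda>s. s\<^sup>2"], rule sum.cong)
      fix j assume "j \<in> {..<r}"
      then show "M $$ (i, j) * u j = sqrt (M $$ (i, j) * x j) * (sqrt (M $$ (i, j) / x j) * u j)"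
        using nonneg[OF i, of j] x(1)[of j] by (simp add: real_sqrt_mult real_sqrt_divide)
    qed simp
    also have "\<dots> \<le> (\<Sum>j<r. (sqrt (M $$ (i, j) * x j))\<^sup>2) * (\<Sum>j<r. (sqrt (M $$ (i, j) / x j) * u j)\<^sup>2)"
      by (rule sum_mult_squared_le)
    also have "\<dots> = (\<Sum>j<r. M $$ (i, j) * x j) * ?S"
      using nonneg i x(1)
      by (intro arg_cong2[where f = "(*)"] sum.cong) (auto simp: power_mult_distrib less_imp_le)
    also have "\<dots> \<le> x i * ?S" using S x(2)[OF i] by (intro mult_right_mono) auto
    finally have "z i / x i * (\<Sum>j<r. M $$ (i, j) * u j)\<^sup>2 \<le> z i / x i * (x i * ?S)"
      using x(1)[OF i] z(1)[OF i] by (intro mult_left_mono) auto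
    then show ?thesis using x(1)[OF i] by simp
  qed
  have "(\<Sum>i<r. z i / x i * (\<Sum>j<r. M $$ (i, j) * u j)\<^sup>2)
      \<le> (\<Sum>i<r. z i * (\<Sum>j<r. M $$ (i, j) * ((u j)\<^sup>2 / x j)))"
    using row by (intro sum_mono) auto
  also have "\<dots> = (\<Sum>j<r. (\<Sum>i<r. M $$ (i, j) * z i) * ((u j)\<^sup>2 / x j))"
    unfolding sum_distrib_left sum_distrib_right
    by (subst sum.swap) (simp add: algebra_simps)
  also have "\<dots> < (\<Sum>j<r. z j * ((u j)\<^sup>2 / x j))"
  proof (rule sum_strict_mono_ex1)
    from u obtain j where "j < r" "u j \<noteq> 0" by auto
    then show "\<exists>j\<in>{..<r}. (\<Sum>i<r. M $$ (i, j) * z i) * ((u j)\<^sup>2 / x j) < z j * ((u j)\<^sup>2 / x j)"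
      using x(1)[of j] z(2)[of j] by (intro bexI[of _ j] mult_strict_right_mono) auto
  next
    show "\<forall>j\<in>{..<r}. (\<Sum>i<r. M $$ (i, j) * z i) * ((u j)\<^sup>2 / x j) \<le> z j * ((u j)\<^sup>2 / x j)"
      using x(1) z(2) by (intro ballI mult_right_mono) (auto simp: less_imp_le)
  qed simp
  finally show ?thesis by simp
qed

section \<open>Decay of matrix powers and the Neumann series\<close>

lemma smult_pow_mat:
  fixes N :: "'a :: comm_semiring_1 mat"
  assumes N: "N \<in> carrier_mat r r"
  shows "(c \<cdot>\<^sub>m N) ^\<^sub>m m = c ^ m \<cdot>\<^sub>m (N ^\<^sub>m m)"
proof (induction m)
  case 0
  show ?case using N by (intro eq_matI) auto
next
  case (Suc m)
  have "N ^\<^sub>m m \<in> carrier_mat r r" using N by simp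
  then have "c ^ m \<cdot>\<^sub>m (N ^\<^sub>m m) * (c \<cdot>\<^sub>m N) = c ^ Suc m \<cdot>\<^sub>m (N ^\<^sub>m m * N)"
    using N by (intro eq_matI) (auto simp: scalar_prod_def sum_distrib_left algebra_simps intro!: sum.cong)
  then show ?case using Suc by simp
qed

text \<open>The library bounds the powers of a matrix with spectral radius below 1 by a constant only;
  applied to \<open>t\<^sup>-\<^sup>1 M\<close> with \<open>\<rho>(M) < t < 1\<close> this becomes geometric decay.\<close>

lemma schur_matrix_pow_bound:
  assumes M: "M \<in> carrier_mat r r" and r: "r > 0" and schur: "schur_matrix M"
  shows "\<exists>t c. 0 < t \<and> t < 1 \<and> (\<forall>i<r. \<forall>j<r. \<forall>m. \<bar>(M ^\<^sub>m m) $$ (i, j)\<bar> \<le> c * t ^ m)"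
proof -
  let ?C = "map_mat complex_of_real"
  have C: "?C M \<in> carrier_mat r r" using M by simp
  have "0 \<le> spectral_radius (?C M)" using spectral_radius_mem_max(1)[OF C r] by auto
  moreover obtain t where t: "spectral_radius (?C M) < t" "t < 1"
    using schur unfolding schur_matrix_def by (meson dense)
  ultimately have t0: "t > 0" by linarith
  define N where "N = (1 / t) \<cdot>\<^sub>m M"
  have N: "N \<in> carrier_mat r r" using M by (simp add: N_def)
  have MN: "M = t \<cdot>\<^sub>m N" using M t0 by (intro eq_matI) (auto simp: N_def)
  have CN: "?C N \<in> carrier_mat r r" using N by simp
  \<comment> \<open>An eigenvector of \<open>N\<close> for \<open>a\<close> is one of
    \<open>M = t N\<close> for \<open>t * a\<close>, so a dominant eigenvalue of \<open>N\<close>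
    has modulus at most the spectral radius of \<open>M\<close> divided by \<open>t\<close>.\<close>
  have "spectral_radius (?C N) < 1"
  proof -
    obtain a where a: "eigenvalue (?C N) a" "spectral_radius (?C N) = cmod a"
      using spectral_radius_mem_max(1)[OF CN r] by (auto simp: spectrum_def)
    from a(1) obtain v where v: "v \<in> carrier_vec r" "v \<noteq> 0\<^sub>v r" "?C N *\<^sub>v v = a \<cdot>\<^sub>v v"
      using N unfolding eigenvalue_def eigenvector_def by auto
    have "?C M *\<^sub>v v = complex_of_real t \<cdot>\<^sub>v (?C N *\<^sub>v v)"
      using N v(1) unfolding MN
      by (intro eq_vecI) (auto simp: scalar_prod_def sum_distrib_left algebra_simps intro!: sum.cong)
    then have "?C M *\<^sub>v v = (complex_of_real t * a) \<cdot>\<^sub>v v"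
      using v by (simp add: smult_smult_assoc)
    then have "eigenvalue (?C M) (complex_of_real t * a)"
      using v M unfolding eigenvalue_def eigenvector_def by auto
    then have "cmod (complex_of_real t * a) \<le> spectral_radius (?C M)"
      by (intro spectral_radius_mem_max(2)[OF C r]) (auto simp: spectrum_def)
    moreover have "cmod (complex_of_real t * a) = t * cmod a" using t0 by (simp add: norm_mult)
    ultimately have "t * cmod a < t * 1" using t(1) by simp
    then show ?thesis using t0 a(2) by simp
  qed
  then obtain c where c: "\<And>m. norm_bound (?C N ^\<^sub>m m) c"
    using spectral_radius_jnf_norm_bound_less_1_upper_triangular[OF CN] by blast
  have "\<bar>(M ^\<^sub>m m) $$ (i, j)\<bar> \<le> c * t ^ m" if ij: "i < r" "j < r" for i j m
  proof -
    have "?C N ^\<^sub>m m = ?C (N ^\<^sub>m m)" by (rule of_real_hom.mat_hom_pow[OF N, symmetric])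
    then have "\<bar>(N ^\<^sub>m m) $$ (i, j)\<bar> \<le> c"
      using c[of m] ij N unfolding norm_bound_def by auto
    moreover have "(M ^\<^sub>m m) $$ (i, j) = t ^ m * (N ^\<^sub>m m) $$ (i, j)"
      using ij N unfolding MN smult_pow_mat[OF N] by simp
    ultimately show ?thesis
      using t0 by (simp add: abs_mult mult.commute mult_right_mono)
  qed
  then show ?thesis using t0 t(2) by blast
qed

text \<open>The series is summed entry by entry, with the geometric bound for convergence. Splitting
  off the term \<open>m = 0\<close> yields \<open>B = I + B M\<close>.\<close>

lemma schur_matrix_nonneg_inverse:
  assumes M: "M \<in> carrier_mat r r" and r: "r > 0" and schur: "schur_matrix M"
    and nonneg: "\<And>i j. i < r \<Longrightarrow> j < r \<Longrightarrow> 0 \<le> M $$ (i, j)"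
  obtains B where "B \<in> carrier_mat r r" "(1\<^sub>m r - M) * B = 1\<^sub>m r" "0\<^sub>m r r \<le> B"
proof -
  obtain t c where t: "0 < t" "t < 1"
    and bound: "\<forall>i<r. \<forall>j<r. \<forall>m. \<bar>(M ^\<^sub>m m) $$ (i, j)\<bar> \<le> c * t ^ m"
    using schur_matrix_pow_bound[OF M r schur] by blast
  have P: "M ^\<^sub>m m \<in> carrier_mat r r" for m using M by simp
  have pow_Suc: "(M ^\<^sub>m Suc m) $$ (i, j) = (\<Sum>l<r. (M ^\<^sub>m m) $$ (i, l) * M $$ (l, j))"
    if "i < r" "j < r" for i j m
    using index_mult_mat_sum[OF P M that] by simp
  have pow_nonneg: "0 \<le> (M ^\<^sub>m m) $$ (i, j)" if "i < r" "j < r" for i j m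
    using that
  proof (induction m arbitrary: i j)
    case 0
    then show ?case using M by (simp add: one_mat_def)
  next
    case (Suc m)
    then show ?case unfolding pow_Suc[OF Suc.prems]
      using nonneg by (intro sum_nonneg mult_nonneg_nonneg) auto
  qed
  have summ: "summable (\<lambda>m. (M ^\<^sub>m m) $$ (i, j))" if "i < r" "j < r" for i j
  proof (rule summable_comparison_test)
    show "summable (\<lambda>m. c * t ^ m)" using t by (intro summable_mult summable_geometric) auto
  qed (use bound that in auto)
  define B where "B = mat r r (\<lambda>(i, j). \<Sum>m. (M ^\<^sub>m m) $$ (i, j))"
  have B: "B \<in> carrier_mat r r" by (simp add: B_def)
  have B_nonneg: "0\<^sub>m r r \<le> B"
    using pow_nonneg summ by (auto simp: less_eq_mat_def B_def intro!: suminf_nonneg)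
  have B_eq: "B $$ (i, j) = 1\<^sub>m r $$ (i, j) + (\<Sum>l<r. B $$ (i, l) * M $$ (l, j))"
    if ij: "i < r" "j < r" for i j
  proof -
    have "B $$ (i, j) = (\<Sum>m. (M ^\<^sub>m Suc m) $$ (i, j)) + (M ^\<^sub>m 0) $$ (i, j)"
      using suminf_split_head[OF summ[OF ij]] ij by (simp add: B_def)
    also have "(\<Sum>m. (M ^\<^sub>m Suc m) $$ (i, j)) = (\<Sum>m. \<Sum>l<r. (M ^\<^sub>m m) $$ (i, l) * M $$ (l, j))"
      by (simp only: pow_Suc[OF ij])
    \<comment> \<open>A finite sum of convergent series may be exchanged with the limit.\<close>
    also have "\<dots> = (\<Sum>l<r. \<Sum>m. (M ^\<^sub>m m) $$ (i, l) * M $$ (l, j))"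
      using summ ij by (intro suminf_sum summable_mult2) auto
    also have "\<dots> = (\<Sum>l<r. B $$ (i, l) * M $$ (l, j))"
      using summ ij by (intro sum.cong) (auto simp: B_def suminf_mult2)
    finally show ?thesis using M by simp
  qed
  have "B * (1\<^sub>m r - M) = B - B * M"
    using B mult_minus_distrib_mat[OF B one_carrier_mat M] by simp
  also have "\<dots> = 1\<^sub>m r"
  proof (rule eq_matI)
    fix i j assume "i < dim_row (1\<^sub>m r :: real mat)" "j < dim_col (1\<^sub>m r :: real mat)"
    then have ij: "i < r" "j < r" by auto
    have "(B - B * M) $$ (i, j) = B $$ (i, j) - (B * M) $$ (i, j)" using ij M B by simp
    then show "(B - B * M) $$ (i, j) = 1\<^sub>m r $$ (i, j)"
      unfolding index_mult_mat_sum[OF B M ij] using B_eq[OF ij] by linarith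
  qed (use M B in auto)
  \<comment> \<open>Powers grow by a factor on the right, so the recursion produces a left inverse;
    for square matrices it is also a right inverse.\<close>
  finally have "(1\<^sub>m r - M) * B = 1\<^sub>m r"
    by (rule mat_mult_left_right_inverse[OF B minus_carrier_mat[OF M]])
  then show thesis using that[OF B _ B_nonneg] by blast
qed

section \<open>Positive vectors from a non-negative inverse\<close>

text \<open>For the all-ones vector \<open>e\<close>, the vector \<open>x = B e\<close> solves
  \<open>(I - M) x = e\<close>, so \<open>M x\<close> lies below \<open>x\<close> by exactly 1 in
  every coordinate.\<close>

lemma subinvariant_if_nonneg_inverse:
  fixes M B :: "real mat"
  assumes M: "M \<in> carrier_mat r r" and B: "B \<in> carrier_mat r r"
    and inv: "(1\<^sub>m r - M) * B = 1\<^sub>m r"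
    and nonneg: "\<And>i j. i < r \<Longrightarrow> j < r \<Longrightarrow> 0 \<le> B $$ (i, j)"
  obtains x where "x \<in> carrier_vec r" "0\<^sub>v r \<lless>\<^sub>v x" "M *\<^sub>v x \<lless>\<^sub>v x"
proof -
  let ?e = "vec r (\<lambda>_. 1 :: real)"
  let ?x = "B *\<^sub>v ?e"
  have x: "?x \<in> carrier_vec r" using B by auto
  have inv': "B * (1\<^sub>m r - M) = 1\<^sub>m r"
    using mat_mult_left_right_inverse[OF minus_carrier_mat[OF M] B inv] .
  have x_eq: "?x $ i = (\<Sum>j<r. B $$ (i, j))" if "i < r" for i
    using index_mult_mat_vec_sum[OF B _ that, of ?e] by simp
  have pos: "0 < ?x $ i" if i: "i < r" for i
  proof (rule ccontr)
    \<comment> \<open>A row sum of non-negative entries that is not positive forces row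
      \<open>i\<close> of \<open>B\<close> to vanish, which contradicts the diagonal entry 1 of
      \<open>B (I - M)\<close>.\<close>
    assume "\<not> 0 < ?x $ i"
    then have "(\<Sum>j<r. B $$ (i, j)) = 0"
      using x_eq[OF i] sum_nonneg[of "{..<r}" "\<lambda>j. B $$ (i, j)"] nonneg[OF i] by simp
    then have z: "B $$ (i, j) = 0" if "j < r" for j
      using nonneg[OF i] that by (subst (asm) sum_nonneg_eq_0_iff) auto
    have "(B * (1\<^sub>m r - M)) $$ (i, i) = (\<Sum>l<r. B $$ (i, l) * (1\<^sub>m r - M) $$ (l, i))"
      by (rule index_mult_mat_sum[OF B minus_carrier_mat[OF M] i i])
    also have "\<dots> = 0" using z by simp
    finally show False using inv' i by simp
  qed
  have "?x - M *\<^sub>v ?x = (1\<^sub>m r - M) *\<^sub>v ?x"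
    using M x by (simp add: minus_mult_distrib_mat_vec[OF one_carrier_mat])
  also have "\<dots> = ((1\<^sub>m r - M) * B) *\<^sub>v ?e"
    by (rule assoc_mult_mat_vec[OF minus_carrier_mat[OF M] B, symmetric]) simp
  also have "\<dots> = ?e" using inv by simp
  finally have diff: "?x - M *\<^sub>v ?x = ?e" .
  have "(M *\<^sub>v ?x) $ i < ?x $ i" if "i < r" for i
  proof -
    have "(?x - M *\<^sub>v ?x) $ i = 1" using diff that by simp
    then show ?thesis using that M B by simp
  qed
  then show thesis using that[OF x] pos M B by (auto simp: vec_lless_def)
qed

text \<open>Lets the preceding construction run on \<open>M\<^sup>T\<close>, producing
  \<open>z\<close>. Transposition reverses products, so it is applied to the identity
  \<open>B (I - M) = I\<close>.\<close>

lemma nonneg_inverse_transpose: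
  fixes M B :: "'a :: field mat"
  assumes M: "M \<in> carrier_mat r r" and B: "B \<in> carrier_mat r r"
    and inv: "(1\<^sub>m r - M) * B = 1\<^sub>m r"
  shows "(1\<^sub>m r - M\<^sup>T) * B\<^sup>T = 1\<^sub>m r"
proof -
  have "B * (1\<^sub>m r - M) = 1\<^sub>m r" using mat_mult_left_right_inverse[OF minus_carrier_mat[OF M] B inv] .
  then have "(1\<^sub>m r - M)\<^sup>T * B\<^sup>T = 1\<^sub>m r"
    using transpose_mult[OF B minus_carrier_mat[OF M], of "1\<^sub>m r"] by simp
  moreover have "(1\<^sub>m r - M)\<^sup>T = 1\<^sub>m r - M\<^sup>T" using M by (intro eq_matI) auto
  ultimately show ?thesis by simp
qed

section \<open>The Loewner inequality for diagonal \<open>D\<close> as an inequality of sums\<close>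

text \<open>Moving \<open>M\<^sup>T\<close> across the scalar product turns the form of
  \<open>M\<^sup>T * D * M\<close> at \<open>x\<close> into that of \<open>D\<close> at
  \<open>M x\<close>; for diagonal \<open>D\<close> both forms are weighted sums of squares.\<close>

lemma diagonal_mat_sandwich:
  fixes M D :: "real mat"
  assumes M: "M \<in> carrier_mat r r" and D: "D \<in> carrier_mat r r" and diag: "diagonal_mat D"
  shows "transpose_mat (M\<^sup>T * D * M) = M\<^sup>T * D * M" "D\<^sup>T = D"
    and "x \<in> carrier_vec r \<Longrightarrow> x \<bullet> ((D - M\<^sup>T * D * M) *\<^sub>v x) =
      (\<Sum>i<r. D $$ (i, i) * (x $ i)\<^sup>2) - (\<Sum>i<r. D $$ (i, i) * (\<Sum>j<r. M $$ (i, j) * x $ j)\<^sup>2)"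
proof -
  show DT: "D\<^sup>T = D"
  proof (rule eq_matI)
    fix i j assume "i < dim_row D" "j < dim_col D"
    then show "D\<^sup>T $$ (i, j) = D $$ (i, j)"
      using D diag by (cases "i = j") (auto simp: diagonal_mat_def)
  qed (use D in auto)
  have MT: "M\<^sup>T \<in> carrier_mat r r" using M by simp
  have MTD: "M\<^sup>T * D \<in> carrier_mat r r" using MT D by simp
  show "transpose_mat (M\<^sup>T * D * M) = M\<^sup>T * D * M"
    using transpose_mult[OF MTD M] transpose_mult[OF MT D] DT assoc_mult_mat[OF MT D M] by simp
  assume x: "x \<in> carrier_vec r"
  have quad: "y \<bullet> (D *\<^sub>v y) = (\<Sum>i<r. D $$ (i, i) * (y $ i)\<^sup>2)" if y: "y \<in> carrier_vec r" for y
  proof -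
    have "(D *\<^sub>v y) $ i = D $$ (i, i) * y $ i" if i: "i < r" for i
    proof -
      have "(D *\<^sub>v y) $ i = (\<Sum>j<r. D $$ (i, j) * y $ j)"
        by (rule index_mult_mat_vec_sum[OF D y i])
      also have "\<dots> = (\<Sum>j<r. if j = i then D $$ (i, i) * y $ i else 0)"
        using diag D i by (intro sum.cong) (auto simp: diagonal_mat_def)
      finally show ?thesis using i by simp
    qed
    then show ?thesis using D y
      by (auto simp: scalar_prod_def lessThan_atLeast0 power2_eq_square algebra_simps intro!: sum.cong)
  qed
  have Mx: "M *\<^sub>v x \<in> carrier_vec r" using M x by simp
  have "(D - M\<^sup>T * D * M) *\<^sub>v x = D *\<^sub>v x - M\<^sup>T *\<^sub>v (D *\<^sub>v (M *\<^sub>v x))"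
    using minus_mult_distrib_mat_vec[OF D mult_carrier_mat[OF MTD M] x]
    unfolding assoc_mult_mat_vec[OF MTD M x] assoc_mult_mat_vec[OF MT D Mx] .
  moreover have "x \<bullet> (D *\<^sub>v x - M\<^sup>T *\<^sub>v (D *\<^sub>v (M *\<^sub>v x))) =
      x \<bullet> (D *\<^sub>v x) - x \<bullet> (M\<^sup>T *\<^sub>v (D *\<^sub>v (M *\<^sub>v x)))"
    using M D MT x Mx by (intro scalar_prod_minus_distrib[of _ r]) auto
  moreover have "x \<bullet> (M\<^sup>T *\<^sub>v (D *\<^sub>v (M *\<^sub>v x))) = (M *\<^sub>v x) \<bullet> (D *\<^sub>v (M *\<^sub>v x))"
  proof -
    have "D *\<^sub>v (M *\<^sub>v x) \<in> carrier_vec r" using D Mx by simp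
    then show ?thesis
      using transpose_vec_mult_scalar[OF M x, of "D *\<^sub>v (M *\<^sub>v x)"] x M D Mx
      by (metis comm_scalar_prod mult_mat_vec_carrier MT)
  qed
  ultimately show "x \<bullet> ((D - M\<^sup>T * D * M) *\<^sub>v x) =
      (\<Sum>i<r. D $$ (i, i) * (x $ i)\<^sup>2) - (\<Sum>i<r. D $$ (i, i) * (\<Sum>j<r. M $$ (i, j) * x $ j)\<^sup>2)"
    using quad[OF x] quad[OF Mx] index_mult_mat_vec_sum[OF M x] by simp
qed

text \<open>Both sides of the order are symmetric, so only positivity of the quadratic form remains.
  Quantifying over functions matches the form used by the Stein lemmas; \<open>vec r x\<close> links
  the two.\<close>

lemma loewner_less_diagonal_iff:
  fixes M D :: "real mat"
  assumes M: "M \<in> carrier_mat r r" and D: "D \<in> carrier_mat r r" and diag: "diagonal_mat D"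
  shows "M\<^sup>T * D * M \<prec>\<^sub>m D \<longleftrightarrow> (\<forall>x. (\<exists>i<r. x i \<noteq> 0) \<longrightarrow>
    (\<Sum>i<r. D $$ (i, i) * (\<Sum>j<r. M $$ (i, j) * x j)\<^sup>2) < (\<Sum>i<r. D $$ (i, i) * (x i)\<^sup>2))"
    (is "_ \<longleftrightarrow> ?R")
proof -
  note sandwich = diagonal_mat_sandwich[OF M D diag]
  have E: "D - M\<^sup>T * D * M \<in> carrier_mat r r" "M\<^sup>T * D * M \<in> carrier_mat r r" using M D by auto
  have "(D - M\<^sup>T * D * M)\<^sup>T = D - M\<^sup>T * D * M"
    using sandwich(1,2) transpose_minus[OF D E(2)] by simp
  then have "M\<^sup>T * D * M \<prec>\<^sub>m D \<longleftrightarrow> (\<forall>x\<in>carrier_vec r. x \<noteq> 0\<^sub>v r \<longrightarrow>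
      0 < x \<bullet> ((D - M\<^sup>T * D * M) *\<^sub>v x))"
    using sandwich(1,2) E D M unfolding loewner_less_def pos_def_mat_def by simp
  also have "\<dots> \<longleftrightarrow> ?R"
  proof (intro iffI allI impI ballI)
    fix x :: "nat \<Rightarrow> real"
    assume L: "\<forall>x\<in>carrier_vec r. x \<noteq> 0\<^sub>v r \<longrightarrow> 0 < x \<bullet> ((D - M\<^sup>T * D * M) *\<^sub>v x)"
      and "\<exists>i<r. x i \<noteq> 0"
    then have "vec r x \<noteq> 0\<^sub>v r" by (auto simp: vec_eq_iff)
    then have "0 < vec r x \<bullet> ((D - M\<^sup>T * D * M) *\<^sub>v vec r x)"
      using L[rule_format, OF vec_carrier] by blast
    then show "(\<Sum>i<r. D $$ (i, i) * (\<Sum>j<r. M $$ (i, j) * x j)\<^sup>2) < (\<Sum>i<r. D $$ (i, i) * (x i)\<^sup>2)"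
      using sandwich(3)[of "vec r x"] by simp
  next
    fix x :: "real vec"
    assume ?R and x: "x \<in> carrier_vec r" "x \<noteq> 0\<^sub>v r"
    moreover from x have "\<exists>i<r. x $ i \<noteq> 0" by (auto simp: vec_eq_iff)
    ultimately show "0 < x \<bullet> ((D - M\<^sup>T * D * M) *\<^sub>v x)" using sandwich(3)[OF x(1)] by simp
  qed
  finally show ?thesis .
qed

section \<open>The equivalences for an arbitrary non-negative matrix\<close>

lemma schur_matrix_nonneg_equivalences:
  assumes M: "M \<in> carrier_mat r r" and r: "r > 0"
    and nonneg: "\<And>i j. i < r \<Longrightarrow> j < r \<Longrightarrow> 0 \<le> M $$ (i, j)"
  shows "schur_matrix M \<longleftrightarrow> (\<exists>\<xi> \<in> carrier_vec r. 0\<^sub>v r \<lless>\<^sub>v \<xi> \<and> M *\<^sub>v \<xi> \<lless>\<^sub>v \<xi>)" (is "?a \<longleftrightarrow> ?b")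
    and "schur_matrix M \<longleftrightarrow> (\<exists>z \<in> carrier_vec r. 0\<^sub>v r \<lless>\<^sub>v z \<and> M\<^sup>T *\<^sub>v z \<lless>\<^sub>v z)" (is "_ \<longleftrightarrow> ?c")
    and "schur_matrix M \<longleftrightarrow> (\<exists>D \<in> carrier_mat r r. diagonal_mat D \<and> (\<forall>i < r. 0 < D $$ (i, i)) \<and>
      M\<^sup>T * D * M \<prec>\<^sub>m D)" (is "_ \<longleftrightarrow> ?d")
    and "schur_matrix M \<longleftrightarrow> (\<exists>B \<in> carrier_mat r r. (1\<^sub>m r - M) * B = 1\<^sub>m r \<and> 0\<^sub>m r r \<le> B)"
      (is "_ \<longleftrightarrow> ?e")
proof -
  have MT: "M\<^sup>T \<in> carrier_mat r r" using M by simp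
  have rows: "0 < \<xi> $ i" "(\<Sum>j<r. M $$ (i, j) * \<xi> $ j) < \<xi> $ i"
    if "\<xi> \<in> carrier_vec r" "0\<^sub>v r \<lless>\<^sub>v \<xi>" "M *\<^sub>v \<xi> \<lless>\<^sub>v \<xi>" "i < r" for \<xi> i
    using that index_mult_mat_vec_sum[OF M that(1,4)] by (auto simp: vec_lless_def)
  have cols: "0 < z $ j" "(\<Sum>i<r. M $$ (i, j) * z $ i) < z $ j"
    if "z \<in> carrier_vec r" "0\<^sub>v r \<lless>\<^sub>v z" "M\<^sup>T *\<^sub>v z \<lless>\<^sub>v z" "j < r" for z j
    using that index_mult_mat_vec_sum[OF MT that(1,4)] M by (auto simp: vec_lless_def)
  have ae: ?e if ?a
    by (rule schur_matrix_nonneg_inverse[OF M r that nonneg]) auto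
  have eb: ?b if ?e
  proof -
    from that obtain B where B: "B \<in> carrier_mat r r" "(1\<^sub>m r - M) * B = 1\<^sub>m r" "0\<^sub>m r r \<le> B" by blast
    have "\<And>i j. i < r \<Longrightarrow> j < r \<Longrightarrow> 0 \<le> B $$ (i, j)"
      using B(1,3) by (auto simp: less_eq_mat_def)
    then obtain \<xi> where "\<xi> \<in> carrier_vec r" "0\<^sub>v r \<lless>\<^sub>v \<xi>" "M *\<^sub>v \<xi> \<lless>\<^sub>v \<xi>"
      by (rule subinvariant_if_nonneg_inverse[OF M B(1,2)])
    then show ?thesis by blast
  qed
  have ec: ?c if ?e
  proof -
    from that obtain B where B: "B \<in> carrier_mat r r" "(1\<^sub>m r - M) * B = 1\<^sub>m r" "0\<^sub>m r r \<le> B" by blast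
    have "B\<^sup>T \<in> carrier_mat r r" "\<And>i j. i < r \<Longrightarrow> j < r \<Longrightarrow> 0 \<le> B\<^sup>T $$ (i, j)"
      using B(1,3) by (auto simp: less_eq_mat_def)
    then obtain z where "z \<in> carrier_vec r" "0\<^sub>v r \<lless>\<^sub>v z" "M\<^sup>T *\<^sub>v z \<lless>\<^sub>v z"
      using subinvariant_if_nonneg_inverse[OF MT _ nonneg_inverse_transpose[OF M B(1,2)]] by metis
    then show ?thesis by blast
  qed
  have ba: ?a if ?b
  proof -
    from that obtain \<xi> where "\<xi> \<in> carrier_vec r" "0\<^sub>v r \<lless>\<^sub>v \<xi>" "M *\<^sub>v \<xi> \<lless>\<^sub>v \<xi>" by blast
    then show ?thesis using rows[of \<xi>]
      by (intro schur_matrix_if_subinvariant[OF M r nonneg, where x = "\<lambda>i. \<xi> $ i"]) auto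
  qed
  have ca: ?a if ?c
  proof -
    from that obtain z where "z \<in> carrier_vec r" "0\<^sub>v r \<lless>\<^sub>v z" "M\<^sup>T *\<^sub>v z \<lless>\<^sub>v z" by blast
    then show ?thesis using cols[of z]
      by (intro schur_matrix_if_transpose_subinvariant[OF M r nonneg, where z = "\<lambda>i. z $ i"]) auto
  qed
  \<comment> \<open>The diagonal witness combines both vectors, so this implication starts from (b)
    and (c) together.\<close>
  have bcd: ?d if ?b ?c
  proof -
    from that obtain \<xi> z
      where \<xi>: "\<xi> \<in> carrier_vec r" "0\<^sub>v r \<lless>\<^sub>v \<xi>" "M *\<^sub>v \<xi> \<lless>\<^sub>v \<xi>"
        and z: "z \<in> carrier_vec r" "0\<^sub>v r \<lless>\<^sub>v z" "M\<^sup>T *\<^sub>v z \<lless>\<^sub>v z" by blast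
    define D where "D = mat r r (\<lambda>(i, j). if i = j then z $ i / \<xi> $ i else 0)"
    have D: "D \<in> carrier_mat r r" "diagonal_mat D" by (auto simp: D_def diagonal_mat_def)
    have "\<forall>i<r. 0 < D $$ (i, i)" using rows(1)[OF \<xi>] cols(1)[OF z] by (auto simp: D_def)
    moreover have "M\<^sup>T * D * M \<prec>\<^sub>m D"
      unfolding loewner_less_diagonal_iff[OF M D]
      using stein_if_subinvariant[OF nonneg rows[OF \<xi>] cols[OF z]] by (simp add: D_def)
    ultimately show ?thesis using D by blast
  qed
  have da: ?a if ?d
  proof -
    from that obtain D where D: "D \<in> carrier_mat r r" "diagonal_mat D"
      and pos: "\<And>i. i < r \<Longrightarrow> 0 < D $$ (i, i)" and less: "M\<^sup>T * D * M \<prec>\<^sub>m D" by blast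
    show ?thesis
      using less unfolding loewner_less_diagonal_iff[OF M D]
      by (intro schur_matrix_if_stein[OF M r, where d = "\<lambda>i. D $$ (i, i)"] pos) auto
  qed
  \<comment> \<open>From (a) one reaches (e), then (b) and (c), then (d); each of (b), (c), (d)
    leads back to (a).\<close>
  show "?a \<longleftrightarrow> ?b" "?a \<longleftrightarrow> ?c" "?a \<longleftrightarrow> ?d" "?a \<longleftrightarrow> ?e"
    using ae eb ec ba ca bcd da by argo+
qed

section \<open>Specialisation to the multiplicative compound\<close>

theorem corollary1:
  fixes n k r :: nat and A :: "real mat"
  assumes "n \<ge> 2"
    and "k \<in> {1..n - 1}"
    and "r = n choose k"
    and "A \<in> carrier_mat n n"
    and "sign_regular k 1 A"
  shows
    "(schur_matrix (mult_compound k A) \<longleftrightarrow>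
       (\<exists>\<xi> \<in> carrier_vec r. 0\<^sub>v r \<lless>\<^sub>v \<xi> \<and> mult_compound k A *\<^sub>v \<xi> \<lless>\<^sub>v \<xi>))
   \<and> (schur_matrix (mult_compound k A) \<longleftrightarrow>
       (\<exists>z \<in> carrier_vec r. 0\<^sub>v r \<lless>\<^sub>v z \<and> (mult_compound k A)\<^sup>T *\<^sub>v z \<lless>\<^sub>v z))
   \<and> (schur_matrix (mult_compound k A) \<longleftrightarrow>
       (\<exists>D \<in> carrier_mat r r. diagonal_mat D \<and> (\<forall>i < r. 0 < D $$ (i, i)) \<and>
          (mult_compound k A)\<^sup>T * D * mult_compound k A \<prec>\<^sub>m D))
   \<and> (schur_matrix (mult_compound k A) \<longleftrightarrow>
       invertible_mat (1\<^sub>m r - mult_compound k A) \<and>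
       (\<exists>B \<in> carrier_mat r r.
          inverts_mat (1\<^sub>m r - mult_compound k A) B \<and>
          inverts_mat B (1\<^sub>m r - mult_compound k A) \<and>
          0\<^sub>m r r \<le> B))"
proof -
  let ?M = "mult_compound k A"
  have M: "?M \<in> carrier_mat r r" using mult_compound_carrier assms(3,4) by blast
  \<comment> \<open>The range of \<open>k\<close> gives \<open>k \<le> n\<close>, so the compound is
    not an empty matrix.\<close>
  have r: "r > 0" using assms(2,3) by (auto simp: zero_less_binomial_iff)
  have nonneg: "0 \<le> ?M $$ (i, j)" if "i < r" "j < r" for i j
    using assms(5) M that by (auto simp: sign_regular_def)
  \<comment> \<open>Statement (e), with invertibility and a two-sided inverse, reduces to a
    non-negative right inverse because \<open>I - M\<close> is square.\<close>
  have inv: "(invertible_mat (1\<^sub>m r - ?M) \<and> (\<exists>B \<in> carrier_mat r r.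
        inverts_mat (1\<^sub>m r - ?M) B \<and> inverts_mat B (1\<^sub>m r - ?M) \<and> 0\<^sub>m r r \<le> B)) \<longleftrightarrow>
      (\<exists>B \<in> carrier_mat r r. (1\<^sub>m r - ?M) * B = 1\<^sub>m r \<and> 0\<^sub>m r r \<le> B)" (is "?L \<longleftrightarrow> ?R")
  proof
    assume ?L
    then show ?R using M by (auto simp: inverts_mat_def)
  next
    assume ?R
    then obtain B where B: "B \<in> carrier_mat r r" "(1\<^sub>m r - ?M) * B = 1\<^sub>m r" "0\<^sub>m r r \<le> B" by blast
    have "B * (1\<^sub>m r - ?M) = 1\<^sub>m r" using mat_mult_left_right_inverse[OF minus_carrier_mat[OF M] B(1,2)] .
    then have "inverts_mat (1\<^sub>m r - ?M) B" "inverts_mat B (1\<^sub>m r - ?M)"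
      using B M by (auto simp: inverts_mat_def)
    then show ?L using B M by (auto simp: invertible_mat_def)
  qed
  show ?thesis
    using schur_matrix_nonneg_equivalences[OF M r nonneg] unfolding inv by blast
qed

end
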